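(* Let $k\ge 1$ and let $f_1,f_2,\ldots,f_k$ be entire functions. Suppose that, for all $j\in\{1,2,\ldots,k\}$, $f_j$ has the annular domain property for some $m>1$. Suppose also that, for some $j\in\{1,2,\ldots,k\}$, $f_j$ is a log-regular transcendental entire function. Let $g=f_1\circ f_2\circ\cdots\circ f_k$. Then $A_R(g)$ is a spider's web, where $R>0$ is such that $M(r,g)>r$ for $r\ge R$.
   Context: For an entire function $f$ put $M(r,f)=\max_{|z|=r}|f(z)|$ for $r>0$. $f^n$ is the $n$th iterate of $f$, and $M^n(R,f)$ is the $n$th iterate of the map $r\mapsto M(r,f)$ applied to $R$. $\mathbb N=\{1,2,\ldots\}$ and $B(0,r)=\{z\in\mathbb C:|z|<r\}$. For a transcendental entire function $f$ and $R>0$ with $M(r,f)>r$ for all $r\ge R$, define $A_R(f)=\{z\in\mathbb C: |f^n(z)|\ge M^n(R,f)\text{ for } n\in\mathbb N\}$. A set $E\subset\mathbb C$ is a spider's web if $E$ is connected and there is a sequence $(G_n)_{n\in\mathbb N}$ of bounded simply connected domains with $G_n\subset G_{n+1}$ and $\partial G_n\subset E$ for all $n\in\mathbb N$, and $\bigcup_{n\in\mathbb N}G_n=\mathbb C$. An entire function $f$ has the annular domain property for $m>1$ if there exists $R_0>0$ such that, for all $r\ge R_0$, there is a simply connected domain $G=G(r)$ with $B(0,r)\subset G\subset B(0,r^m)$ and $|f(z)|\ge M(r,f)$ for all $z\in\partial G$. A transcendental entire function $f$ is log-regular (with constant $c>0$) if $\phi(t)=\log M(e^t,f)$ satisfies $\phi'(t)/\phi(t)\ge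 (1+c)/t$ for all large $t$; it is log-regular if this holds for some $c>0$. (Since $\phi$ is convex, $\phi'$ exists outside a countable set; at exceptional points $\phi'$ is read as the right derivative.) *)

theory Defs
  imports
    "HOL-Complex_Analysis.Complex_Analysis"
    "HOL-Computational_Algebra.Polynomial"
begin

definition entire :: "(complex \<Rightarrow> complex) \<Rightarrow> bool" where
  "entire f \<longleftrightarrow> f holomorphic_on UNIV"

definition transcendental_entire :: "(complex \<Rightarrow> complex) \<Rightarrow> bool" where
  "transcendental_entire f \<longleftrightarrow> entire f \<and> \<not> (\<exists>p :: complex poly. \<forall>z. f z = poly p z)"

text \<open>
  A supremum is used because \<open>Max\<close> is only meaningful on finite sets; for
  entire \<open>f\<close> and \<open>r \<ge> 0\<close> it is attained (lemma \<open>max_modulus_attained\<close>).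
  For \<open>r < 0\<close> the value is unspecified.
\<close>

definition max_modulus :: "real \<Rightarrow> (complex \<Rightarrow> complex) \<Rightarrow> real" where
  "max_modulus r f = (SUP z\<in>sphere 0 r. cmod (f z))"

lemma max_modulus_attained:
  assumes "entire f" "r \<ge> 0"
  shows "\<exists>z\<in>sphere 0 r. max_modulus r f = cmod (f z) \<and> (\<forall>w\<in>sphere 0 r. cmod (f w) \<le> cmod (f z))"
proof -
  have "continuous_on (sphere 0 r) (\<lambda>z. cmod (f z))"
    using assms(1) unfolding entire_def
    by (intro continuous_on_norm holomorphic_on_imp_continuous_on)
       (rule holomorphic_on_subset, auto)
  moreover have "sphere (0::complex) r \<noteq> {}"
    using assms(2) by simp
  ultimately obtain z where z: "z \<in> sphere 0 r" "\<forall>w\<in>sphere 0 r. cmod (f w) \<le> cmod (f z)"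
    using continuous_attains_sup[OF compact_sphere] by blast
  then have "max_modulus r f = cmod (f z)"
    unfolding max_modulus_def by (intro cSup_eq_maximum) auto
  then show ?thesis
    using z by blast
qed

text \<open>
  The condition starts at the first iterate: \<open>cmod z \<ge> R\<close> is not required.
\<close>

definition A_set :: "real \<Rightarrow> (complex \<Rightarrow> complex) \<Rightarrow> complex set" where
  "A_set R f = {z. \<forall>n\<ge>1. cmod ((f ^^ n) z) \<ge> ((\<lambda>r. max_modulus r f) ^^ n) R}"

definition simply_connected_domain :: "complex set \<Rightarrow> bool" where
  "simply_connected_domain G \<longleftrightarrow> open G \<and> connected G \<and> G \<noteq> {} \<and> simply_connected G"

definition spiders_web :: "complex set \<Rightarrow> bool" where
  "spiders_web E \<longleftrightarrow> connected E \<and>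
     (\<exists>G :: nat \<Rightarrow> complex set.
        (\<forall>n. bounded (G n) \<and> simply_connected_domain (G n) \<and>
             G n \<subseteq> G (Suc n) \<and> frontier (G n) \<subseteq> E) \<and>
        (\<Union>n. G n) = UNIV)"

definition annular_domain_property :: "real \<Rightarrow> (complex \<Rightarrow> complex) \<Rightarrow> bool" where
  "annular_domain_property m f \<longleftrightarrow>
     (\<exists>R0>0. \<forall>r\<ge>R0. \<exists>G. simply_connected_domain G \<and>
        ball 0 r \<subseteq> G \<and> G \<subseteq> ball 0 (r powr m) \<and>
        (\<forall>z\<in>frontier G. cmod (f z) \<ge> max_modulus r f))"

text \<open>
  The function \<open>\<phi>(t) = log M(e\<^sup>t, f)\<close> is convex for transcendental entire
  \<open>f\<close>, so its right derivative exists everywhere (once \<open>\<phi>\<close> is real-valued, which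
  holds as \<open>f\<close> is not identically zero) and agrees with the derivative wherever
  the latter exists.
\<close>

definition log_max_modulus :: "(complex \<Rightarrow> complex) \<Rightarrow> real \<Rightarrow> real" where
  "log_max_modulus f t = ln (max_modulus (exp t) f)"

definition log_regular_with :: "real \<Rightarrow> (complex \<Rightarrow> complex) \<Rightarrow> bool" where
  "log_regular_with c f \<longleftrightarrow>
     (\<forall>\<^sub>F t in at_top. \<exists>D. (log_max_modulus f has_real_derivative D) (at_right t) \<and>
        D / log_max_modulus f t \<ge> (1 + c) / t)"

definition log_regular :: "(complex \<Rightarrow> complex) \<Rightarrow> bool" where
  "log_regular f \<longleftrightarrow> transcendental_entire f \<and> (\<exists>c>0. log_regular_with c f)"

end

theory Submission
  imports Defs "HOL-Real_Asymp.Real_Asymp"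
begin

text \<open>
  Let \<open>C\<close> be a connected set that joins the disc of radius \<open>\<rho>\<close> to the complement of the disc of
  radius \<open>\<rho> powr d\<close>, where \<open>d \<ge> m\<close>. The annular domain property gives a domain between the discs of
  radii \<open>\<rho> powr (d/m)\<close> and \<open>\<rho> powr d\<close> whose boundary meets \<open>C\<close>, so \<open>f(C)\<close> leaves the disc of radius
  \<open>M(\<rho> powr (d/m), f)\<close>. By Hadamard's three circles theorem this radius is at least
  \<open>M(\<rho>, f) powr (d/2m)\<close>, and at least \<open>M(\<rho>, f) powr ((d/m) powr (1 + c/2))\<close> for a log-regular \<open>f\<close>.
  Hence each factor of \<open>g\<close> reduces the exponent at most by a constant factor, and for \<open>d\<close> large the
  log-regular factor makes up for all these losses: \<open>g(C)\<close> leaves the disc of radius \<open>M(\<rho>, g) powr d\<close>.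

  Iterating this, a connected set that contains \<open>0\<close> and lies in the increasing union of the sets
  \<open>|g\<^sup>n| < M\<^sup>n(R, g)\<close>, the complement of \<open>A_set R g\<close>, stays in the disc of radius \<open>R powr d\<close> when
  \<open>R\<close> is large. So the component of \<open>0\<close> in this complement is bounded; it is simply connected by the
  maximum principle, and its boundary lies in \<open>A_set R g\<close>. Replacing \<open>R\<close> by \<open>R' + N\<close> yields the nested
  domains of the spider's web. Finally, the maximum principle rules out compact relatively open
  parts of \<open>A_set R g\<close>, which together with the connected boundaries makes \<open>A_set R g\<close> connected.
\<close>

section \<open>The maximum modulus\<close>

lemma entire_continuous: "entire f \<Longrightarrow> continuous_on S f"
  unfolding entire_def
  by (meson continuous_on_subset holomorphic_on_imp_continuous_on subset_UNIV)

lemma entire_compose: "entire f \<Longrightarrow> entire h \<Longrightarrow> entire (h \<circ> f)"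
  unfolding entire_def by (rule holomorphic_on_compose_gen) auto

lemma entire_funpow: "entire f \<Longrightarrow> entire (f ^^ n)"
  by (induction n) (auto simp: entire_compose, simp add: entire_def id_def)

lemma cmod_le_max_modulus_sphere:
  assumes "entire f" "cmod z = r"
  shows "cmod (f z) \<le> max_modulus r f"
  using max_modulus_attained[of f r] assms by (metis dist_0_norm mem_sphere norm_ge_zero)

lemma cmod_le_max_modulus:
  assumes "entire f" "cmod z \<le> r"
  shows "cmod (f z) \<le> max_modulus r f"
proof (cases "cmod z = r")
  case False
  then have "z \<in> ball 0 r" using assms by simp
  moreover have "f holomorphic_on interior (ball 0 r)"
    using assms(1) entire_def holomorphic_on_subset by blast
  moreover have "cmod (f w) \<le> max_modulus r f" if "w \<in> frontier (ball 0 r)" for w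
  proof -
    have "r > 0" using assms False by (metis less_eq_real_def norm_ge_zero order_le_less_trans)
    then show ?thesis
      using that assms by (intro cmod_le_max_modulus_sphere) (auto simp: frontier_ball)
  qed
  ultimately show ?thesis
    using maximum_modulus_frontier[of f "ball 0 r"] entire_continuous[OF assms(1)] by blast
qed (use assms cmod_le_max_modulus_sphere in auto)

lemma max_modulus_nonneg: "entire f \<Longrightarrow> r \<ge> 0 \<Longrightarrow> max_modulus r f \<ge> 0"
  using max_modulus_attained[of f r] by (metis norm_ge_zero)

text \<open>Strictness, from the maximum modulus principle, keeps images of open discs inside open
  discs. It makes \<open>stretches\<close> compose and the sets \<open>below n\<close>
  increase.\<close>

lemma cmod_less_max_modulus:
  assumes f: "entire f" and nc: "\<not> f constant_on UNIV" and "cmod z < r"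
  shows "cmod (f z) < max_modulus r f"
proof (rule ccontr)
  assume "\<not> ?thesis"
  then have eq: "cmod (f z) = max_modulus r f"
    using cmod_le_max_modulus[OF f, of z r] assms by linarith
  have "f constant_on UNIV"
  proof (rule maximum_modulus_principle)
    show "cmod (f w) \<le> cmod (f z)" if "w \<in> ball 0 r" for w
      using that eq cmod_le_max_modulus[OF f, of w r] by simp
  qed (use assms in \<open>auto simp: entire_def\<close>)
  with nc show False by simp
qed

lemma max_modulus_mono:
  assumes "entire f" "0 \<le> r" "r \<le> s"
  shows "max_modulus r f \<le> max_modulus s f"
  using max_modulus_attained[of f r] cmod_le_max_modulus[of f _ s] assms
  by (metis mem_sphere dist_0_norm)

text \<open>By Liouville's theorem. In a composition it turns a property of the outer map at all
  large radii into one at the radii \<open>max_modulus r f\<close>.\<close>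

lemma max_modulus_at_top:
  assumes f: "entire f" and nc: "\<not> f constant_on UNIV"
  shows "filterlim (\<lambda>r. max_modulus r f) at_top at_top"
proof (rule ccontr)
  assume "\<not> ?thesis"
  then obtain B where B: "\<not> (\<forall>\<^sub>F r in at_top. B \<le> max_modulus r f)"
    by (auto simp: filterlim_at_top)
  have "cmod (f z) \<le> B" for z
  proof -
    obtain r where "r \<ge> cmod z" "\<not> B \<le> max_modulus r f"
      using B by (meson eventually_at_top_linorderI)
    then show ?thesis using cmod_le_max_modulus[OF f, of z r] by linarith
  qed
  then have "bounded (range f)"
    by (auto simp: bounded_iff)
  then show False
    using Liouville_theorem f nc unfolding entire_def by blast
qed

lemma max_modulus_compose_le:
  assumes "entire f" "entire h" "r \<ge> 0"
  shows "max_modulus r (h \<circ> f) \<le> max_modulus (max_modulus r f) h"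
proof -
  obtain z where "cmod z = r" "max_modulus r (h \<circ> f) = cmod (h (f z))"
    using max_modulus_attained[OF entire_compose, of f h r] assms by auto
  then show ?thesis
    using cmod_le_max_modulus assms by (metis order_refl)
qed

lemma max_modulus_id: "r \<ge> 0 \<Longrightarrow> max_modulus r id = r"
  using max_modulus_attained[of id r] by (auto simp: entire_def id_def)

section \<open>Growth of the maximum modulus when the radius is raised to a power\<close>

text \<open>
  Dividing \<open>f^q\<close> by the integer power \<open>z^p\<close> stands in for dividing \<open>f\<close> by the multivalued
  \<open>z powr (p/q)\<close>, with \<open>p/q\<close> near the slope of \<open>log_max_modulus f\<close>.
\<close>

lemma max_modulus_three_circles:
  assumes f: "entire f" and r: "1 < r" "r < r'"
  shows "max_modulus r f ^ q \<le> max (max_modulus 1 f ^ q) (max_modulus r' f ^ q / r' ^ p) * r ^ p"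
proof -
  obtain z where z: "cmod z = r" "max_modulus r f = cmod (f z)"
    using max_modulus_attained[OF f, of r] r by auto
  define S where "S = ball 0 r' - cball (0::complex) 1"
  define F where "F = (\<lambda>z. f z ^ q / z ^ p)"
  have clS: "closure S \<subseteq> cball 0 r' - ball 0 1"
    unfolding S_def by (rule closure_minimal) (auto intro!: closed_Diff)
  have S: "open S" unfolding S_def by auto
  have frS: "cmod w = 1 \<or> cmod w = r'" if "w \<in> frontier S" for w
  proof -
    have "w \<in> closure S" "w \<notin> S"
      using that S by (auto simp: frontier_def interior_open)
    then have "w \<in> cball 0 r' - ball 0 1" using clS by blast
    then show ?thesis using \<open>w \<notin> S\<close> by (simp add: S_def) linarith
  qed
  have hol: "F holomorphic_on (- {0})"
  proof -
    have "f holomorphic_on (- {0})" using f entire_def holomorphic_on_subset by blast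
    then show ?thesis unfolding F_def by (intro holomorphic_intros) auto
  qed
  have "0 \<notin> closure S" using clS by auto
  then have "F holomorphic_on closure S" by (intro holomorphic_on_subset[OF hol]) auto
  have "cmod (F z) \<le> max (max_modulus 1 f ^ q) (max_modulus r' f ^ q / r' ^ p)"
  proof (rule maximum_modulus_frontier[where f = F and S = S])
    show "F holomorphic_on interior S"
      using \<open>F holomorphic_on closure S\<close> interior_subset closure_subset
      by (meson holomorphic_on_subset order_trans)
    show "continuous_on (closure S) F"
      using \<open>F holomorphic_on closure S\<close> by (rule holomorphic_on_imp_continuous_on)
    show "bounded S" unfolding S_def by (simp add: bounded_diff)
    show "z \<in> S" using z r by (simp add: S_def)
  next
    fix w assume "w \<in> frontier S"
    then consider "cmod w = 1" | "cmod w = r'" using frS by blast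
    then show "cmod (F w) \<le> max (max_modulus 1 f ^ q) (max_modulus r' f ^ q / r' ^ p)"
    proof cases
      case 1
      then have "cmod (F w) \<le> max_modulus 1 f ^ q"
        using cmod_le_max_modulus[OF f, of w 1]
        by (simp add: F_def norm_divide norm_power power_mono)
      then show ?thesis by simp
    next
      case 2
      then have "cmod (F w) \<le> max_modulus r' f ^ q / r' ^ p"
        using cmod_le_max_modulus[OF f, of w r'] r
        by (simp add: F_def norm_divide norm_power power_mono divide_right_mono)
      then show ?thesis by simp
    qed
  qed
  then show ?thesis
    using z r by (simp add: F_def norm_divide norm_power pos_divide_le_eq)
qed

text \<open>Three circles of radii \<open>1\<close>, \<open>r\<close> and \<open>r powr s\<close>.
  The factor \<open>1 / 2\<close> in the exponent pays for the value at radius \<open>1\<close> and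
  for a rational slope \<open>p / q\<close>.\<close>

lemma max_modulus_powr_ge:
  assumes f: "entire f" and nc: "\<not> f constant_on UNIV" and s: "s \<ge> 1"
  shows "\<forall>\<^sub>F r in at_top. max_modulus r f powr (s / 2) \<le> max_modulus (r powr s) f"
proof -
  let ?M = "\<lambda>r. max_modulus r f"
  have M1: "?M 1 > 0"
    using cmod_less_max_modulus[OF f nc, of 0 1] by (simp add: le_less_trans[OF norm_ge_zero])
  have "\<forall>\<^sub>F r in at_top. ?M r > max 1 (?M 1 ^ 2)"
    using max_modulus_at_top[OF f nc] unfolding filterlim_at_top_dense by blast
  with eventually_gt_at_top[of 1] show ?thesis
  proof eventually_elim
    case (elim r)
    then have r: "r > 1" and Mr: "?M r > 1" "?M r > ?M 1 ^ 2" by auto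
    show ?case
    proof (cases "s = 1")
      \<comment> \<open>The three circles need \<open>r < r'\<close>, which fails for
        \<open>s = 1\<close>.\<close>
      case True
      have "?M r powr (1/2) \<le> ?M r powr 1"
        using Mr by (intro powr_mono) auto
      then show ?thesis using True r Mr by simp
    next
      case False
      then have s: "s > 1" using s by simp
      have t: "ln r > 0" using r by simp
      define a where "a = ln (?M r)"
      have a: "a > 0" using Mr a_def by simp
      have "ln (?M 1 ^ 2) < a"
        unfolding a_def using Mr M1 by (subst ln_less_cancel_iff) auto
      then have a1: "2 * ln (?M 1) < a" using M1 by (simp add: ln_realpow)
      \<comment> \<open>In terms of \<open>log_max_modulus g\<close> with \<open>f\<close> for
        \<open>g\<close>, the upper bound on \<open>x\<close> is the chord slope between
        \<open>0\<close> and \<open>ln r\<close>. The lower bound is half of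
        \<open>a / ln r\<close>; \<open>a1\<close> makes the interval nonempty.\<close>
      obtain x where x: "x \<in> \<rat>" "a / (2 * ln r) < x" "x < (a - ln (?M 1)) / ln r"
        using Rats_dense_in_real[of "a / (2 * ln r)" "(a - ln (?M 1)) / ln r"] a1 t
        by (auto simp: field_simps)
      have "x > 0"
        using x(2) a t by (metis divide_pos_pos mult_pos_pos less_trans zero_less_numeral)
      then obtain p q :: nat where q: "q > 0" and "x = real p / real q"
        using Rats_abs_nat_div_natE[OF x(1)] by (metis abs_of_pos neq0_conv)
      then have xq: "x * q = p" by simp
      have "a < 2 * x * ln r" "x * ln r < a - ln (?M 1)"
        using x(2,3) t by (auto simp: field_simps)
      then have "a * q < 2 * x * ln r * q" "x * ln r * q < (a - ln (?M 1)) * q"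
        using q by auto
      then have x: "a * q < 2 * p * ln r" "p * ln r < q * (a - ln (?M 1))"
        by (simp_all add: xq[symmetric] mult_ac)
      define r' where "r' = r powr s"
      have r': "r < r'" unfolding r'_def using r s powr_less_mono[of 1 s r] by simp
      have M': "?M r \<le> ?M r'" using max_modulus_mono[OF f] r r' by simp
      have l': "ln r' = s * ln r" unfolding r'_def using r by (simp add: ln_powr)
      \<comment> \<open>The upper bound on the slope excludes the inner circle, so the outer one
        realises the maximum.\<close>
      have "\<not> ?M r ^ q \<le> ?M 1 ^ q * r ^ p"
      proof
        assume "?M r ^ q \<le> ?M 1 ^ q * r ^ p"
        then have "ln (?M r ^ q) \<le> ln (?M 1 ^ q * r ^ p)"
          using Mr M1 r by (subst ln_le_cancel_iff) auto
        then show False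
          using x(2) M1 r Mr by (simp add: ln_realpow ln_mult a_def algebra_simps)
      qed
      then have "?M r ^ q \<le> ?M r' ^ q / r' ^ p * r ^ p"
        using max_modulus_three_circles[OF f r r', of q p] r
        by (auto simp: max_def split: if_splits)
      then have "?M r ^ q * r' ^ p \<le> ?M r' ^ q * r ^ p"
        using r r' by (simp add: field_simps)
      then have "ln (?M r ^ q * r' ^ p) \<le> ln (?M r' ^ q * r ^ p)"
        using Mr M' r r' by (subst ln_le_cancel_iff) auto
      then have "q * a + p * (s * ln r) \<le> q * ln (?M r') + p * ln r"
        using Mr M' r r' by (simp add: ln_realpow ln_mult a_def l')
      \<comment> \<open>With the lower bound on the slope this gives
        \<open>(s + 1) / 2 * a \<le> ln (?M r')\<close>; the surplus \<open>a / 2\<close> is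
        dropped.\<close>
      moreover have "(s - 1) * (a * q) \<le> (s - 1) * (2 * p * ln r)"
        using x s by (intro mult_left_mono) auto
      moreover have "q * a > 0" using q a by simp
      ultimately have "q * (s / 2 * a) \<le> q * ln (?M r')"
        by (simp add: algebra_simps)
      then have "s / 2 * a \<le> ln (?M r')"
        using q by simp
      then have "exp (s / 2 * a) \<le> exp (ln (?M r'))" by simp
      moreover have "?M r powr (s / 2) = exp (s / 2 * a)"
        unfolding powr_def a_def using Mr by simp
      moreover have "?M r' > 0" using Mr M' by simp
      ultimately show ?thesis by (simp only: exp_ln r'_def)
    qed
  qed
qed

text \<open>The function \<open>log_max_modulus f x * x powr (-p)\<close> has positive right
  derivative for \<open>x \<ge> T\<close>. One-sided derivatives do not integrate directly, so the
  inequality is pushed from \<open>a\<close> to \<open>b\<close> by a supremum argument.\<close>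

lemma log_max_modulus_powr_growth:
  assumes f: "entire f" and nc: "\<not> f constant_on UNIV" and c: "0 < c"
    and reg: "\<And>t. t \<ge> T \<Longrightarrow> log_max_modulus f t > 0 \<and> (\<exists>D. (log_max_modulus f has_real_derivative D) (at_right t) \<and>
        D / log_max_modulus f t \<ge> (1 + c) / t)"
    and p: "1 \<le> p" "p < 1 + c"
    and ab: "0 < T" "T \<le> a" "a \<le> b"
  shows "log_max_modulus f a * (b / a) powr p \<le> log_max_modulus f b"
proof -
  let ?\<phi> = "log_max_modulus f"
  have a: "a > 0" using ab by simp
  have mono: "?\<phi> x \<le> ?\<phi> y" if "a \<le> x" "x \<le> y" for x y
  proof -
    have "max_modulus (exp x) f > 0" if "x \<ge> a" for x
      using cmod_less_max_modulus[OF f nc, of 0 "exp x"] by (simp add: le_less_trans[OF norm_ge_zero])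
    then show ?thesis
      using that max_modulus_mono[OF f, of "exp x" "exp y"]
      unfolding log_max_modulus_def by (subst ln_le_cancel_iff) auto
  qed
  define S where "S = {x \<in> {a..b}. ?\<phi> a * (x / a) powr p \<le> ?\<phi> x}"
  have aS: "a \<in> S" using a ab by (simp add: S_def)
  have bdd: "bdd_above S" by (auto simp: S_def bdd_above_def)
  define s where "s = Sup S"
  have s: "a \<le> s" "s \<le> b"
    unfolding s_def using aS bdd ab by (auto intro!: cSup_upper cSup_least simp: S_def)
  \<comment> \<open>Monotonicity of \<open>?\<phi>\<close> replaces left continuity in the passage
    to the supremum.\<close>
  have s_ge: "?\<phi> a * (s / a) powr p \<le> ?\<phi> s"
  proof -
    have "s \<in> closure S" unfolding s_def using aS bdd by (intro closure_contains_Sup) auto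
    then obtain X where X: "\<And>n. X n \<in> S" "X \<longlonglongrightarrow> s"
      by (auto simp: closure_sequential)
    have "?\<phi> a * (X n / a) powr p \<le> ?\<phi> s" for n
    proof -
      have "X n \<le> s" unfolding s_def using X bdd by (intro cSup_upper)
      then show ?thesis using X(1)[of n] mono[of "X n" s] by (auto simp: S_def)
    qed
    moreover have "(\<lambda>n. ?\<phi> a * (X n / a) powr p) \<longlonglongrightarrow> ?\<phi> a * (s / a) powr p"
      using X(2) a s by (intro tendsto_intros) auto
    ultimately show ?thesis by (intro LIMSEQ_le_const2) auto
  qed
  have "s = b"
  proof (rule ccontr)
    assume "s \<noteq> b"
    then have sb: "s < b" using s by simp
    have s0: "s > 0" using a s by simp
    have pos: "?\<phi> s > 0" using reg s ab by auto
    obtain D where D: "(?\<phi> has_real_derivative D) (at_right s)" "D / ?\<phi> s \<ge> (1 + c) / s"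
      using reg s ab by (meson order_trans)
    \<comment> \<open>The gap \<open>p < 1 + c\<close> makes the right derivative strictly positive,
      so the inequality extends beyond \<open>s\<close>.\<close>
    have "p / s < D / ?\<phi> s"
      using D(2) p s0 by (meson divide_strict_right_mono less_le_trans)
    then have "D * s > p * ?\<phi> s" using pos s0 by (simp add: field_simps)
    have "((\<lambda>x. ?\<phi> x * x powr (-p)) has_real_derivative
            (?\<phi> s * (-p * s powr (-p - 1)) + D * s powr (-p))) (at_right s)"
      using s0 by (intro DERIV_cong[OF DERIV_mult[OF D(1) has_field_derivative_at_within[OF has_real_derivative_powr]]]) auto
    moreover have "?\<phi> s * (-p * s powr (-p - 1)) + D * s powr (-p) = s powr (-p - 1) * (D * s - p * ?\<phi> s)"
      using s0 powr_add[of s "-p - 1" 1] by (simp add: algebra_simps)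
    ultimately obtain d where d: "d > 0" "\<And>h. h > 0 \<Longrightarrow> h < d \<Longrightarrow> ?\<phi> s * s powr (-p) < ?\<phi> (s + h) * (s + h) powr (-p)"
      using has_real_derivative_pos_inc_right[of "\<lambda>x. ?\<phi> x * x powr (-p)" _ s "{s<..}"] \<open>D * s > p * ?\<phi> s\<close> s0
      by fastforce
    define h where "h = min (d / 2) (b - s)"
    have h: "h > 0" "h < d" "s + h \<le> b" using d(1) sb by (auto simp: h_def)
    have "?\<phi> a * a powr (-p) \<le> ?\<phi> s * s powr (-p)"
      using s_ge a s0 by (simp add: powr_divide powr_minus field_simps)
    also have "\<dots> < ?\<phi> (s + h) * (s + h) powr (-p)" using d(2) h by blast
    finally have "?\<phi> a * ((s + h) / a) powr p \<le> ?\<phi> (s + h)"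
      using a s0 h by (simp add: powr_divide powr_minus field_simps)
    then have "s + h \<in> S" using h s by (simp add: S_def)
    then have "s + h \<le> s" unfolding s_def using bdd by (intro cSup_upper)
    then show False using h by simp
  qed
  then show ?thesis using s_ge by simp
qed

text \<open>Growth with \<open>p = 1 + c / 2\<close> between \<open>ln r\<close> and
  \<open>s * ln r\<close>. The exponent is superlinear in \<open>s\<close>, which is what outweighs
  linear losses.\<close>

lemma max_modulus_powr_ge_log_regular:
  assumes f: "entire f" and nc: "\<not> f constant_on UNIV" and c: "0 < c" "log_regular_with c f" and s: "s \<ge> 1"
  shows "\<forall>\<^sub>F r in at_top. max_modulus r f powr (s powr (1 + c / 2)) \<le> max_modulus (r powr s) f"
proof -
  let ?M = "\<lambda>r. max_modulus r f"
  have M1: "\<forall>\<^sub>F r in at_top. ?M r > 1"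
    using max_modulus_at_top[OF f nc] unfolding filterlim_at_top_dense by blast
  then have "\<forall>\<^sub>F t in at_top. ?M (exp t) > 1"
    using exp_at_top filterlim_iff by blast
  then have "\<forall>\<^sub>F t in at_top. log_max_modulus f t > 0 \<and> (\<exists>D. (log_max_modulus f has_real_derivative D) (at_right t) \<and>
        D / log_max_modulus f t \<ge> (1 + c) / t)"
    using c(2) unfolding log_regular_with_def
    by eventually_elim (auto simp: log_max_modulus_def)
  then obtain T0 where T0: "\<And>t. t \<ge> T0 \<Longrightarrow> log_max_modulus f t > 0 \<and> (\<exists>D. (log_max_modulus f has_real_derivative D) (at_right t) \<and>
        D / log_max_modulus f t \<ge> (1 + c) / t)"
    by (auto simp: eventually_at_top_linorder)
  define T where "T = max T0 1"
  show ?thesis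
    using M1 eventually_ge_at_top[of "exp T"]
  proof eventually_elim
    case (elim r)
    have r: "r > 0" using elim by (meson exp_gt_zero less_le_trans)
    have "T \<le> ln r" using elim r by (simp add: ln_ge_iff)
    moreover have "T \<ge> 1" by (simp add: T_def)
    ultimately have t: "ln r \<ge> 1" by simp
    have "log_max_modulus f (ln r) * (s * ln r / ln r) powr (1 + c / 2) \<le> log_max_modulus f (s * ln r)"
    proof (rule log_max_modulus_powr_growth[OF f nc c(1), where T = T])
      show "ln r \<le> s * ln r" using s t by simp
    qed (use T0 c \<open>T \<le> ln r\<close> in \<open>auto simp: T_def\<close>)
    moreover have "s * ln r / ln r = s" "exp (s * ln r) = r powr s" "exp (ln r) = r"
      using r t by (auto simp: powr_def)
    ultimately have "ln (?M r) * s powr (1 + c / 2) \<le> ln (?M (r powr s))"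
      by (simp only: log_max_modulus_def)
    then have "exp (s powr (1 + c / 2) * ln (?M r)) \<le> exp (ln (?M (r powr s)))"
      by (simp add: mult.commute)
    moreover have "?M (r powr s) > 0"
      using cmod_less_max_modulus[OF f nc, of 0 "r powr s"] r by (simp add: le_less_trans[OF norm_ge_zero])
    moreover have "?M r powr (s powr (1 + c / 2)) = exp (s powr (1 + c / 2) * ln (?M r))"
      unfolding powr_def[of "?M r"] using elim by simp
    ultimately show ?case by (simp only: exp_ln)
  qed
qed

section \<open>Stretching of connected sets\<close>

text \<open>Exponents refer to the current scale: \<open>d\<close> to \<open>\<rho>\<close> before
  the map, \<open>e\<close> to \<open>max_modulus \<rho> f\<close> after it. The latter is the next
  \<open>\<rho>\<close>, so exponents chain.\<close>

definition stretches :: "(complex \<Rightarrow> complex) \<Rightarrow> real \<Rightarrow> real \<Rightarrow> bool" where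
  "stretches f d e \<longleftrightarrow>
     (\<forall>\<^sub>F \<rho> in at_top. \<forall>C. connected C \<longrightarrow> C \<inter> ball 0 \<rho> \<noteq> {} \<longrightarrow> \<not> C \<subseteq> ball 0 (\<rho> powr d) \<longrightarrow>
        \<not> f ` C \<subseteq> ball 0 (max_modulus \<rho> f powr e))"

text \<open>The outer map is used at radius \<open>max_modulus \<rho> f\<close>. Its bound involves
  \<open>max_modulus (max_modulus \<rho> f) h\<close>, which dominates the maximum modulus of
  \<open>h \<circ> f\<close>; \<open>e' \<ge> 0\<close> keeps this order under
  \<open>powr\<close>.\<close>

lemma stretches_compose:
  assumes f: "entire f" "\<not> f constant_on UNIV" and h: "entire h" and e': "e' \<ge> 0"
    and sf: "stretches f d e" and sh: "stretches h e e'"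
  shows "stretches (h \<circ> f) d e'"
proof -
  have "\<forall>\<^sub>F \<rho> in at_top. \<forall>C. connected C \<longrightarrow> C \<inter> ball 0 (max_modulus \<rho> f) \<noteq> {} \<longrightarrow>
          \<not> C \<subseteq> ball 0 (max_modulus \<rho> f powr e) \<longrightarrow>
          \<not> h ` C \<subseteq> ball 0 (max_modulus (max_modulus \<rho> f) h powr e')"
    using sh max_modulus_at_top[OF f] unfolding stretches_def filterlim_iff by blast
  with sf eventually_ge_at_top[of 0] show ?thesis
    unfolding stretches_def
  proof eventually_elim
    case (elim \<rho>)
    show ?case
    proof (intro allI impI)
      fix C :: "complex set" assume C: "connected C" "C \<inter> ball 0 \<rho> \<noteq> {}" "\<not> C \<subseteq> ball 0 (\<rho> powr d)"
      have "connected (f ` C)"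
        by (intro connected_continuous_image entire_continuous f C)
      moreover have "f ` C \<inter> ball 0 (max_modulus \<rho> f) \<noteq> {}"
        using C(2) cmod_less_max_modulus[OF f] by fastforce
      ultimately have "\<not> h ` f ` C \<subseteq> ball 0 (max_modulus (max_modulus \<rho> f) h powr e')"
        using elim C by blast
      moreover have "max_modulus \<rho> (h \<circ> f) powr e' \<le> max_modulus (max_modulus \<rho> f) h powr e'"
        using max_modulus_compose_le[OF f(1) h] max_modulus_nonneg[OF entire_compose[OF f(1) h]]
          elim e' by (intro powr_mono2) auto
      ultimately show "\<not> (h \<circ> f) ` C \<subseteq> ball 0 (max_modulus \<rho> (h \<circ> f) powr e')"
        unfolding image_comp[symmetric] by (meson order_trans subset_ball)
    qed
  qed
qed

lemma stretches_mono:
  assumes f: "entire f" "\<not> f constant_on UNIV" and "stretches f d e" "e' \<le> e"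
  shows "stretches f d e'"
proof -
  have "\<forall>\<^sub>F \<rho> in at_top. max_modulus \<rho> f \<ge> 1"
    using max_modulus_at_top[OF f] unfolding filterlim_at_top by blast
  with assms(3) show ?thesis
    unfolding stretches_def
  proof eventually_elim
    case (elim \<rho>)
    then have "ball 0 (max_modulus \<rho> f powr e') \<subseteq> ball (0::complex) (max_modulus \<rho> f powr e)"
      using assms(4) by (intro subset_ball powr_mono)
    with elim show ?case by (meson order_trans)
  qed
qed

lemma annular_domain_property_stretches:
  assumes adp: "annular_domain_property m f" and m: "m > 1" "m \<le> d"
    and growth: "\<forall>\<^sub>F r in at_top. max_modulus r f powr e \<le> max_modulus (r powr (d / m)) f"
  shows "stretches f d e"
proof -
  obtain R0 where R0: "\<And>r. r \<ge> R0 \<Longrightarrow> \<exists>G. simply_connected_domain G \<and>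
        ball 0 r \<subseteq> G \<and> G \<subseteq> ball 0 (r powr m) \<and> (\<forall>z\<in>frontier G. cmod (f z) \<ge> max_modulus r f)"
    using adp unfolding annular_domain_property_def by blast
  show ?thesis
    using growth eventually_ge_at_top[of R0] eventually_ge_at_top[of 1]
    unfolding stretches_def
  proof eventually_elim
    case (elim \<rho>)
    \<comment> \<open>Chosen so that \<open>?r powr m\<close> is the radius that \<open>C\<close>
      leaves; \<open>m \<le> d\<close> puts the disc that \<open>C\<close> meets inside
      \<open>G\<close>.\<close>
    let ?r = "\<rho> powr (d / m)"
    have r: "?r \<ge> \<rho>"
      using powr_mono[of 1 "d / m" \<rho>] elim m by simp
    have "?r powr m = \<rho> powr d"
      using m by (simp add: powr_powr)
    with r R0[of ?r] elim obtain G where G: "ball 0 ?r \<subseteq> G" "G \<subseteq> ball 0 (\<rho> powr d)"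
        "\<And>z. z \<in> frontier G \<Longrightarrow> cmod (f z) \<ge> max_modulus ?r f"
      by auto
    show ?case
    proof (intro allI impI)
      fix C :: "complex set" assume C: "connected C" "C \<inter> ball 0 \<rho> \<noteq> {}" "\<not> C \<subseteq> ball 0 (\<rho> powr d)"
      have "ball 0 \<rho> \<subseteq> G" using G(1) subset_ball[OF r] by blast
      then obtain z where "z \<in> C" "z \<in> frontier G"
        using connected_Int_frontier[OF C(1), of G] C G(2) by blast
      then show "\<not> f ` C \<subseteq> ball 0 (max_modulus \<rho> f powr e)"
        using G(3) elim by fastforce
    qed
  qed
qed

section \<open>Loss and gain of exponents under composition\<close>

definition mildly_contracting :: "(complex \<Rightarrow> complex) \<Rightarrow> bool" where
  "mildly_contracting f \<longleftrightarrow> (\<exists>q\<ge>1. \<forall>d\<ge>q. stretches f d (d / q))"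

text \<open>Quantifying over all \<open>B\<close> lets the gain absorb the loss factor
  \<open>q\<close> of any \<open>mildly_contracting\<close> map.\<close>

definition strongly_stretching :: "(complex \<Rightarrow> complex) \<Rightarrow> bool" where
  "strongly_stretching f \<longleftrightarrow> (\<forall>B\<ge>1. \<exists>D\<ge>1. \<forall>d\<ge>D. stretches f d (B * d))"

text \<open>In \<open>q = 2 * m\<close>, the \<open>m\<close> is the width of the annular domain and
  the \<open>2\<close> comes from \<open>max_modulus_powr_ge\<close>.\<close>

lemma mildly_contracting_if_adp:
  assumes f: "entire f" "\<not> f constant_on UNIV" and m: "m > 1" "annular_domain_property m f"
  shows "mildly_contracting f"
  unfolding mildly_contracting_def
proof (intro exI conjI allI impI)
  show "1 \<le> 2 * m" using m by simp
  fix d assume "2 * m \<le> d"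
  then have "m \<le> d" "d / m \<ge> 1" using m by auto
  then have "stretches f d (d / m / 2)"
    by (intro annular_domain_property_stretches[OF m(2,1)] max_modulus_powr_ge[OF f])
  then show "stretches f d (d / (2 * m))" by (simp add: mult.commute)
qed

lemma strongly_stretching_if_log_regular:
  assumes f: "log_regular f" "\<not> f constant_on UNIV" and m: "m > 1" "annular_domain_property m f"
  shows "strongly_stretching f"
proof -
  obtain c where c: "c > 0" "log_regular_with c f" and ent: "entire f"
    using f(1) unfolding log_regular_def transcendental_entire_def by blast
  show ?thesis
    unfolding strongly_stretching_def
  proof (intro allI impI)
    fix B :: real assume B: "1 \<le> B"
    \<comment> \<open>Once this quantity exceeds \<open>B * m\<close>, multiplying by
      \<open>d / m\<close> gives \<open>(d / m) powr (1 + c / 2) \<ge> B * d\<close>.\<close>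
    have "filterlim (\<lambda>d. (d / m) powr (c / 2)) at_top at_top"
      using c m by real_asymp
    then have "\<forall>\<^sub>F d in at_top. (d / m) powr (c / 2) \<ge> B * m"
      unfolding filterlim_at_top by blast
    then obtain D where D: "\<And>d. d \<ge> D \<Longrightarrow> (d / m) powr (c / 2) \<ge> B * m"
      by (auto simp: eventually_at_top_linorder)
    have "stretches f d (B * d)" if d: "d \<ge> max D m" for d
    proof (rule stretches_mono[OF ent f(2)])
      show "stretches f d ((d / m) powr (1 + c / 2))"
        using d m c by (intro annular_domain_property_stretches[OF m(2,1)]
            max_modulus_powr_ge_log_regular[OF ent f(2)]) auto
      have "d / m * (B * m) \<le> d / m * (d / m) powr (c / 2)"
        using D[of d] d m by (intro mult_left_mono) auto
      also have "\<dots> = (d / m) powr (1 + c / 2)"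
        using d m by (subst powr_add) auto
      finally show "B * d \<le> (d / m) powr (1 + c / 2)"
        using m by (simp add: mult.commute)
    qed
    then show "\<exists>D\<ge>1. \<forall>d\<ge>D. stretches f d (B * d)"
      using m by (intro exI[of _ "max D m"]) auto
  qed
qed

lemma mildly_contracting_id: "mildly_contracting id"
  unfolding mildly_contracting_def stretches_def
proof (intro exI conjI allI impI)
  fix d :: real
  show "\<forall>\<^sub>F \<rho> in at_top. \<forall>C. connected C \<longrightarrow> C \<inter> ball 0 \<rho> \<noteq> {} \<longrightarrow>
      \<not> C \<subseteq> ball 0 (\<rho> powr d) \<longrightarrow> \<not> id ` C \<subseteq> ball (0::complex) (max_modulus \<rho> id powr (d / 1))"
    using eventually_ge_at_top[of 0] by eventually_elim (simp add: max_modulus_id)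
qed simp

lemma mildly_contracting_compose:
  assumes f: "entire f" "\<not> f constant_on UNIV" "mildly_contracting f"
    and h: "entire h" "mildly_contracting h"
  shows "mildly_contracting (h \<circ> f)"
proof -
  obtain q where q: "q \<ge> 1" "\<And>d. d \<ge> q \<Longrightarrow> stretches f d (d / q)"
    using f(3) unfolding mildly_contracting_def by blast
  obtain q' where q': "q' \<ge> 1" "\<And>d. d \<ge> q' \<Longrightarrow> stretches h d (d / q')"
    using h(2) unfolding mildly_contracting_def by blast
  have le: "1 * q \<le> q' * q" "1 \<le> q' * q" using q q' mult_mono[of 1 q' 1 q] by auto
  have "stretches (h \<circ> f) d (d / (q' * q))" if "d \<ge> q' * q" for d
  proof -
    have "d / q \<ge> q'" using that q(1) by (simp add: field_simps)
    moreover have "d \<ge> q" using that le by simp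
    moreover have "d / q / q' = d / (q' * q)" by (simp add: field_simps)
    ultimately have "stretches f d (d / q)" "stretches h (d / q) (d / (q' * q))"
      using q(2) q'(2) by metis+
    then show ?thesis
      using that le by (intro stretches_compose[OF f(1,2) h(1)]) auto
  qed
  then show ?thesis unfolding mildly_contracting_def using le by blast
qed

text \<open>The loss comes first: \<open>d\<close> becomes \<open>d / q\<close>, and a gain of
  \<open>B * q\<close> restores \<open>B * d\<close>. The threshold \<open>D * q\<close> ensures
  \<open>d / q \<ge> D\<close>.\<close>

lemma strongly_stretching_compose_left:
  assumes f: "entire f" "\<not> f constant_on UNIV" "mildly_contracting f"
    and h: "entire h" "strongly_stretching h"
  shows "strongly_stretching (h \<circ> f)"
  unfolding strongly_stretching_def
proof (intro allI impI)
  obtain q where q: "q \<ge> 1" "\<And>d. d \<ge> q \<Longrightarrow> stretches f d (d / q)"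
    using f(3) unfolding mildly_contracting_def by blast
  fix B :: real assume B: "1 \<le> B"
  then have "B * q \<ge> 1" using q mult_mono[of 1 B 1 q] by auto
  then obtain D where D: "D \<ge> 1" "\<And>d. d \<ge> D \<Longrightarrow> stretches h d (B * q * d)"
    using h(2) unfolding strongly_stretching_def by blast
  have le: "1 * q \<le> D * q" "1 \<le> D * q" using q D mult_mono[of 1 D 1 q] by auto
  have "stretches (h \<circ> f) d (B * d)" if "d \<ge> D * q" for d
  proof -
    have "d / q \<ge> D" using that q(1) by (simp add: field_simps)
    moreover have "d \<ge> q" using that le by simp
    moreover have "B * q * (d / q) = B * d" using q by simp
    ultimately have "stretches f d (d / q)" "stretches h (d / q) (B * d)"
      using q(2) D(2) by metis+
    then show ?thesis
      using that le B by (intro stretches_compose[OF f(1,2) h(1)]) auto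
  qed
  then show "\<exists>D\<ge>1. \<forall>d\<ge>D. stretches (h \<circ> f) d (B * d)" using le by blast
qed

text \<open>The gain comes first: the exponent \<open>B * q * d\<close> already exceeds the
  threshold \<open>q\<close> of \<open>h\<close>.\<close>

lemma strongly_stretching_compose_right:
  assumes f: "entire f" "\<not> f constant_on UNIV" "strongly_stretching f"
    and h: "entire h" "mildly_contracting h"
  shows "strongly_stretching (h \<circ> f)"
  unfolding strongly_stretching_def
proof (intro allI impI)
  obtain q where q: "q \<ge> 1" "\<And>d. d \<ge> q \<Longrightarrow> stretches h d (d / q)"
    using h(2) unfolding mildly_contracting_def by blast
  fix B :: real assume B: "1 \<le> B"
  then have Bq: "B * q \<ge> 1" using q mult_mono[of 1 B 1 q] by auto
  then obtain D where D: "D \<ge> 1" "\<And>d. d \<ge> D \<Longrightarrow> stretches f d (B * q * d)"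
    using f(3) unfolding strongly_stretching_def by blast
  have "stretches (h \<circ> f) d (B * d)" if "d \<ge> max D 1" for d
  proof -
    have "q * 1 \<le> q * (B * d)"
      using that q B mult_mono[of 1 B 1 d] by (intro mult_left_mono) auto
    then have "B * q * d \<ge> q" by (simp add: mult_ac)
    moreover have "B * q * d / q = B * d" using q by simp
    ultimately have "stretches h (B * q * d) (B * d)" using q(2) by metis
    then show ?thesis
      using D that B by (intro stretches_compose[OF f(1,2) h(1), of "B * d" d "B * q * d"]) auto
  qed
  then show "\<exists>D\<ge>1. \<forall>d\<ge>D. stretches (h \<circ> f) d (B * d)" by (meson max.cobounded2)
qed

lemma entire_foldr_compose:
  "(\<And>j. j \<in> set xs \<Longrightarrow> entire (f j)) \<Longrightarrow> entire (foldr (\<circ>) (map f xs) id)"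
  by (induction xs) (auto simp: entire_compose, simp add: entire_def id_def)

lemma constant_on_compose:
  assumes "f constant_on UNIV \<or> h constant_on UNIV"
  shows "(h \<circ> f) constant_on UNIV"
  using assms by (auto simp: constant_on_def)

lemma foldr_compose_nonconstant:
  "\<not> foldr (\<circ>) (map f xs) id constant_on UNIV \<Longrightarrow> j \<in> set xs \<Longrightarrow> \<not> f j constant_on UNIV"
  by (induction xs) (use constant_on_compose in fastforce)+

text \<open>The tail of the list is the inner map, so a strong head is composed on the left and a
  strong tail on the right.\<close>

lemma foldr_compose_growth:
  assumes "\<And>j. j \<in> set xs \<Longrightarrow> entire (f j)" "\<And>j. j \<in> set xs \<Longrightarrow> mildly_contracting (f j)"
    and "\<not> foldr (\<circ>) (map f xs) id constant_on UNIV"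
  shows "mildly_contracting (foldr (\<circ>) (map f xs) id) \<and>
    ((\<exists>j\<in>set xs. strongly_stretching (f j)) \<longrightarrow> strongly_stretching (foldr (\<circ>) (map f xs) id))"
  using assms
proof (induction xs)
  case (Cons x xs)
  let ?g = "foldr (\<circ>) (map f xs) id"
  have g: "entire ?g" using Cons.prems by (intro entire_foldr_compose) auto
  have eq: "foldr (\<circ>) (map f (x # xs)) id = f x \<circ> ?g" by simp
  have nc: "\<not> ?g constant_on UNIV"
    using Cons.prems(3) constant_on_compose unfolding eq by blast
  have "\<And>j. j \<in> set xs \<Longrightarrow> entire (f j)" "\<And>j. j \<in> set xs \<Longrightarrow> mildly_contracting (f j)"
    using Cons.prems by auto
  note IH = Cons.IH[OF this nc]
  have x: "entire (f x)" "mildly_contracting (f x)" using Cons.prems by auto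
  show ?case
    unfolding eq
  proof (intro conjI impI)
    show "mildly_contracting (f x \<circ> ?g)"
      using IH by (intro mildly_contracting_compose g nc x) blast
    assume "\<exists>j\<in>set (x # xs). strongly_stretching (f j)"
    then consider "strongly_stretching (f x)" | "strongly_stretching ?g"
      using IH by (metis set_ConsD)
    then show "strongly_stretching (f x \<circ> ?g)"
      using strongly_stretching_compose_left[OF g nc _ x(1)] strongly_stretching_compose_right[OF g nc _ x] IH
      by cases blast+
  qed
qed (simp add: mildly_contracting_id)

section \<open>The topology of the set \<open>A_set R g\<close>\<close>

text \<open>The maximum over the compact frontier is attained, so the strict bound survives the
  maximum principle.\<close>

lemma cmod_less_if_frontier:
  assumes g: "entire g" and U: "bounded U" "open U" "z \<in> U"
    and less: "\<And>w. w \<in> frontier U \<Longrightarrow> cmod (g w) < c"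
  shows "cmod (g z) < c"
proof -
  have "U \<noteq> UNIV" using U(1) not_bounded_UNIV by metis
  then have "frontier U \<noteq> {}" using U frontier_eq_empty by blast
  moreover have "compact (frontier U)" using U(1) by (rule compact_frontier_bounded)
  moreover have "continuous_on (frontier U) (\<lambda>w. cmod (g w))"
    by (intro continuous_on_norm entire_continuous g)
  ultimately obtain w where w: "w \<in> frontier U" "\<And>v. v \<in> frontier U \<Longrightarrow> cmod (g v) \<le> cmod (g w)"
    using continuous_attains_sup[of "frontier U" "\<lambda>w. cmod (g w)"] by blast
  have "cmod (g z) \<le> cmod (g w)"
  proof (rule maximum_modulus_frontier[where f = g and S = U])
    show "g holomorphic_on interior U"
      using g entire_def holomorphic_on_subset by blast
  qed (use U w(2) entire_continuous[OF g] in auto)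
  with less[OF w(1)] show ?thesis by simp
qed

locale max_modulus_escaping =
  fixes g :: "complex \<Rightarrow> complex" and R :: real
  assumes ent: "entire g" and nc: "\<not> g constant_on UNIV"
    and R: "R > 0" and max_modulus_gt: "\<And>r. r \<ge> R \<Longrightarrow> max_modulus r g > r"
begin

abbreviation Mn :: "nat \<Rightarrow> real" where
  "Mn n \<equiv> ((\<lambda>r. max_modulus r g) ^^ n) R"

definition below :: "nat \<Rightarrow> complex set" where
  "below n = {z. cmod ((g ^^ n) z) < Mn n}"

lemma Mn_ge: "Mn n \<ge> R"
  by (induction n) (auto intro: order_trans less_imp_le[OF max_modulus_gt])

lemma below_mono: "m \<le> n \<Longrightarrow> below m \<subseteq> below n"
  by (rule lift_Suc_mono_le) (auto simp: below_def cmod_less_max_modulus[OF ent nc])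

lemma open_below: "open (below n)"
  unfolding below_def
  by (intro open_Collect_less continuous_on_norm entire_continuous entire_funpow ent continuous_on_const)

text \<open>\<open>A_set\<close> starts at \<open>n = 1\<close>; index \<open>0\<close> may be added
  because \<open>below 0\<close> lies in \<open>below 1\<close>.\<close>

lemma Compl_A_set: "- A_set R g = (\<Union>n. below n)"
proof -
  have "below n \<subseteq> (\<Union>n\<in>{1..}. below n)" for n
    using below_mono[of n "Suc n"] by fastforce
  then have "(\<Union>n. below n) = (\<Union>n\<in>{1..}. below n)"
    by blast
  also have "\<dots> = - A_set R g"
    by (auto simp: A_set_def below_def not_le)
  finally show ?thesis ..
qed

lemma closed_A_set: "closed (A_set R g)"
  using open_below Compl_A_set by (metis closed_def open_UN)

text \<open>Compactness singles out one iterate \<open>g ^^ n\<close>, to which the maximum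
  principle can be applied.\<close>

lemma compact_subset_below:
  assumes "compact K" "K \<subseteq> - A_set R g"
  obtains n where "K \<subseteq> below n"
proof -
  obtain N where N: "finite N" "K \<subseteq> (\<Union>n\<in>N. below n)"
    using compactE_image[of K UNIV below] assms open_below unfolding Compl_A_set by metis
  \<comment> \<open>If \<open>N\<close> is empty, so is the union, and the unspecified
    \<open>Max {}\<close> is harmless.\<close>
  have "(\<Union>n\<in>N. below n) \<subseteq> below (Max N)"
    using N(1) by (intro UN_least below_mono) auto
  then show ?thesis using that N(2) by blast
qed

lemma ball_subset_Compl_A_set: "ball 0 R \<subseteq> - A_set R g"
  unfolding Compl_A_set using UN_upper[of 0 UNIV below] by (auto simp: below_def)

lemma A_set_antimono:
  assumes "R \<le> R'"
  shows "A_set R' g \<subseteq> A_set R g"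
proof -
  have le: "Mn n \<le> ((\<lambda>r. max_modulus r g) ^^ n) R'" for n
  proof (induction n)
    case (Suc n)
    then show ?case using Mn_ge[of n] R by (auto intro!: max_modulus_mono[OF ent])
  qed (use assms in simp)
  show ?thesis
    unfolding A_set_def
  proof (intro subsetI CollectI allI impI)
    fix z n assume "z \<in> {z. \<forall>n\<ge>1. ((\<lambda>r. max_modulus r g) ^^ n) R' \<le> cmod ((g ^^ n) z)}" "n \<ge> (1::nat)"
    then have "((\<lambda>r. max_modulus r g) ^^ n) R' \<le> cmod ((g ^^ n) z)" by simp
    with le[of n] show "Mn n \<le> cmod ((g ^^ n) z)" by (rule order_trans)
  qed
qed

text \<open>The maximum principle on a neighbourhood of \<open>B\<close> whose boundary misses \<open>A_set R g\<close>.\<close>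

lemma A_set_no_compact_clopen_part:
  assumes B: "compact B" and C: "closed C" "B \<inter> C = {}" and eq: "B \<union> C = A_set R g"
  shows "B = {}"
proof (rule ccontr)
  assume "B \<noteq> {}"
  then obtain b where b: "b \<in> B" by blast
  obtain U V where U: "open U" "compact (closure U)" "B \<subseteq> U" and V: "open V" "C \<subseteq> V" "U \<inter> V = {}"
    using separation_normal_compact[OF B C] by metis
  \<comment> \<open>The open set \<open>V\<close> keeps \<open>C\<close> away from
    \<open>frontier U\<close>, and \<open>B\<close> lies in the open set \<open>U\<close>.\<close>
  have "closure U \<inter> V = {}" using V open_Int_closure_eq_empty[of V U] by blast
  then have "frontier U \<subseteq> - A_set R g"
    using U V eq by (simp add: frontier_def interior_open) blast
  moreover have "bounded U" using bounded_subset[OF compact_imp_bounded[OF U(2)] closure_subset] .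
  moreover from this have "compact (frontier U)" by (rule compact_frontier_bounded)
  ultimately obtain n where n: "frontier U \<subseteq> below n" using compact_subset_below by blast
  have "b \<in> below n"
    unfolding below_def mem_Collect_eq
  proof (rule cmod_less_if_frontier[OF entire_funpow[OF ent] \<open>bounded U\<close> U(1)])
    show "b \<in> U" using b U(3) by blast
    show "cmod ((g ^^ n) w) < Mn n" if "w \<in> frontier U" for w
      using n that unfolding below_def by blast
  qed
  then show False using b eq Compl_A_set by blast
qed

section \<open>The component of the complement that contains \<open>0\<close>\<close>

definition hole :: "complex set" where
  "hole = connected_component_set (- A_set R g) 0"

lemma open_hole: "open hole"
  unfolding hole_def using closed_A_set by (intro open_connected_component) auto

lemma connected_hole: "connected hole"
  unfolding hole_def by (rule connected_connected_component)

lemma ball_subset_hole: "ball 0 R \<subseteq> hole"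
  unfolding hole_def using R ball_subset_Compl_A_set
  by (intro connected_component_maximal) auto

lemma frontier_hole_subset: "frontier hole \<subseteq> A_set R g"
proof -
  have "frontier hole \<subseteq> frontier (- A_set R g)"
    unfolding hole_def by (rule frontier_of_connected_component_subset)
  then show ?thesis
    using closed_A_set frontier_subset_closed by (auto simp: frontier_complement)
qed

text \<open>A loop in \<open>hole\<close> lies in some \<open>below n\<close>. By the maximum
  principle so does its inside, which therefore belongs to \<open>hole\<close>; points off
  \<open>hole\<close> have winding number zero.\<close>

lemma simply_connected_hole: "simply_connected hole"
  unfolding simply_connected_eq_winding_number_zero[OF open_hole]
proof (intro conjI allI impI connected_hole)
  fix p z assume "path p \<and> path_image p \<subseteq> hole \<and> pathfinish p = pathstart p \<and> z \<notin> hole"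
  then have p: "path p" "path_image p \<subseteq> hole" "pathfinish p = pathstart p" and z: "z \<notin> hole" by auto
  have sub: "hole \<subseteq> - A_set R g" unfolding hole_def by (rule connected_component_subset)
  obtain n where n: "path_image p \<subseteq> below n"
    using compact_subset_below[OF compact_path_image[OF p(1)]] p(2) sub by blast
  let ?I = "inside (path_image p)"
  have cl: "closed (path_image p)" using p(1) by (rule closed_path_image)
  have "?I \<subseteq> below n"
  proof
    fix w assume "w \<in> ?I"
    show "w \<in> below n"
      unfolding below_def mem_Collect_eq
    proof (rule cmod_less_if_frontier[OF entire_funpow[OF ent] _ _ \<open>w \<in> ?I\<close>])
      show "bounded ?I" using bounded_path_image[OF p(1)] by (rule bounded_inside)
      show "open ?I" using cl by (rule open_inside)
      show "cmod ((g ^^ n) v) < Mn n" if "v \<in> frontier ?I" for v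
        using n that frontier_inside_subset[OF cl] unfolding below_def by blast
    qed
  qed
  then have "path_image p \<union> ?I \<subseteq> - A_set R g" using n Compl_A_set by blast
  moreover have "connected (path_image p \<union> ?I)"
    using cl connected_path_image[OF p(1)] by (rule connected_with_inside)
  moreover have "pathstart p \<in> path_image p" by (rule pathstart_in_path_image)
  ultimately have "path_image p \<union> ?I \<subseteq> connected_component_set (- A_set R g) (pathstart p)"
    by (intro connected_component_maximal) auto
  also have "\<dots> = hole"
    using p(2) \<open>pathstart p \<in> path_image p\<close> unfolding hole_def
    by (metis connected_component_eq subsetD)
  finally have "z \<in> outside (path_image p)"
    using z by (simp add: outside_inside) blast
  then show "winding_number p z = 0" using p by (intro winding_number_zero_in_outside)
qed

lemma connected_frontier_hole: "bounded hole \<Longrightarrow> connected (frontier hole)"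
  using simply_connected_hole simply_connected_eq_frontier_properties[OF open_hole] by simp

text \<open>A path from \<open>0\<close> to \<open>w\<close> is compact. This reduces boundedness of
  \<open>hole\<close> to connected sets inside a single \<open>below n\<close>.\<close>

lemma hole_path:
  assumes "w \<in> hole"
  obtains C n where "connected C" "0 \<in> C" "w \<in> C" "C \<subseteq> below n"
proof -
  have "0 \<in> hole" by (rule subsetD[OF ball_subset_hole]) (use R in simp)
  moreover have "path_connected hole"
    using open_hole connected_hole by (rule connected_open_path_connected)
  ultimately obtain p where p: "path p" "path_image p \<subseteq> hole" "pathstart p = 0" "pathfinish p = w"
    using assms unfolding path_connected_def by metis
  moreover have "hole \<subseteq> - A_set R g" unfolding hole_def by (rule connected_component_subset)
  ultimately obtain n where "path_image p \<subseteq> below n"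
    using compact_subset_below[OF compact_path_image[OF p(1)]] by blast
  then show ?thesis
    using that[OF connected_path_image[OF p(1)]] p pathstart_in_path_image pathfinish_in_path_image by metis
qed

text \<open>
  A piece of \<open>A_set R g\<close> that misses a boundary \<open>frontier (G N)\<close> would have a compact part
  inside \<open>G N\<close>.
\<close>

lemma connected_A_set:
  assumes G: "\<And>N. open (G N)" "\<And>N. bounded (G N)" "\<And>N. connected (frontier (G N))"
      "\<And>N. frontier (G N) \<subseteq> A_set R g" "\<And>N::nat. G N \<subseteq> G (Suc N)" "(\<Union>N. G N) = UNIV"
  shows "connected (A_set R g)"
proof -
  have *: "False" if "closed A" "closed B" "b \<in> B" "b \<in> G N" "A \<union> B = A_set R g" "A \<inter> B = {}"
    "frontier (G N) \<subseteq> A" for A B b N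
  proof -
    \<comment> \<open>The frontier belongs to \<open>A\<close>, so cutting \<open>B\<close> along it
      leaves a compact piece.\<close>
    have "B \<inter> closure (G N) \<subseteq> B \<inter> G N"
      using that(6,7) G(1)[of N] by (auto simp: frontier_def interior_open)
    then have eq: "B \<inter> closure (G N) = B \<inter> G N" using closure_subset by blast
    have "B \<inter> G N = {}"
    proof (rule A_set_no_compact_clopen_part[where C = "A \<union> (B - G N)"])
      show "compact (B \<inter> G N)"
        using closed_Int_compact[OF that(2), of "closure (G N)"] G(2)[of N] eq
        by (simp add: compact_closure)
      show "closed (A \<union> (B - G N))" using that G(1) by (intro closed_Un closed_Diff)
      show "B \<inter> G N \<inter> (A \<union> (B - G N)) = {}" "B \<inter> G N \<union> (A \<union> (B - G N)) = A_set R g"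
        using that by auto
    qed
    then show False using that by blast
  qed
  have mono: "G M \<subseteq> G N" if "M \<le> N" for M N
    using G(5) that by (rule lift_Suc_mono_le)
  show ?thesis
    unfolding connected_closed_set[OF closed_A_set]
  proof (rule notI, elim exE conjE)
    fix A B assume AB: "closed A" "closed B" "A \<union> B = A_set R g" "A \<inter> B = {}"
      and "A \<noteq> {}" "B \<noteq> {}"
    then obtain a b where "a \<in> A" "b \<in> B" by blast
    \<comment> \<open>At a level containing both points, the connected frontier lies in one part,
      while the other part has a point inside.\<close>
    obtain K L where "a \<in> G K" "b \<in> G L" using G(6) by blast
    then have ab: "a \<in> G (max K L)" "b \<in> G (max K L)"
      using mono[of K "max K L"] mono[of L "max K L"] by auto
    let ?F = "frontier (G (max K L))"
    have F: "?F \<subseteq> A \<union> B" "A \<inter> B \<inter> ?F = {}" using G(4)[of "max K L"] AB by auto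
    then have "A \<inter> ?F = {} \<or> B \<inter> ?F = {}"
      using connected_closedD[OF G(3) F(2,1) AB(1,2)] by blast
    then show False
    proof
      assume "A \<inter> ?F = {}"
      then have "?F \<subseteq> B" using F by blast
      then show False
        using *[OF AB(2,1) \<open>a \<in> A\<close> ab(1)] AB(3,4) by (simp add: Un_commute Int_commute)
    next
      assume "B \<inter> ?F = {}"
      then have "?F \<subseteq> A" using F by blast
      then show False
        using *[OF AB(1,2) \<open>b \<in> B\<close> ab(2) AB(3,4)] by blast
    qed
  qed
qed

lemma connected_below_subset_ball:
  assumes R1: "R \<ge> 1" and d: "d \<ge> 1"
    and stretch: "\<And>\<rho> C. \<rho> \<ge> R \<Longrightarrow> connected C \<Longrightarrow> C \<inter> ball 0 \<rho> \<noteq> {} \<Longrightarrow>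
        \<not> C \<subseteq> ball 0 (\<rho> powr d) \<Longrightarrow> \<not> g ` C \<subseteq> ball 0 (max_modulus \<rho> g powr d)"
    and C: "connected C" "0 \<in> C" "C \<subseteq> below n"
  shows "C \<subseteq> ball 0 (R powr d)"
proof (rule ccontr)
  assume out: "\<not> C \<subseteq> ball 0 (R powr d)"
  \<comment> \<open>The orbit of \<open>0\<close> keeps every image of \<open>C\<close> in contact
    with the disc of radius \<open>Mn j\<close>, as \<open>stretch\<close> requires.\<close>
  have "0 \<in> below 0" using R by (simp add: below_def)
  then have zero: "0 \<in> below j" for j using below_mono[of 0 j] by blast
  have "connected ((g ^^ j) ` C)" for j
    by (intro connected_continuous_image entire_continuous entire_funpow ent C)
  moreover have "(g ^^ j) ` C \<inter> ball 0 (Mn j) \<noteq> {}" for j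
    using zero[of j] C(2) by (auto simp: below_def)
  ultimately have "\<not> (g ^^ j) ` C \<subseteq> ball 0 (Mn j powr d)" for j
  proof (induction j)
    case (Suc j)
    have "\<not> g ` (g ^^ j) ` C \<subseteq> ball 0 (max_modulus (Mn j) g powr d)"
      using Suc by (intro stretch Mn_ge) auto
    then show ?case by (simp add: image_comp)
  qed (use out in simp)
  from this[of n] have "\<exists>z\<in>C. cmod ((g ^^ n) z) \<ge> Mn n powr d"
    by (simp add: image_subset_iff not_less)
  then obtain z where z: "z \<in> C" "cmod ((g ^^ n) z) \<ge> Mn n powr d" by blast
  have "Mn n powr 1 \<le> Mn n powr d"
    using Mn_ge[of n] R1 d by (intro powr_mono) auto
  then show False
    using z C(3) Mn_ge[of n] R by (auto simp: below_def)
qed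

end

text \<open>Boundedness of holes is available only for large radii. Their frontiers still lie in
  \<open>A_set R g\<close> by \<open>A_set_antimono\<close>.\<close>

lemma spiders_web_A_set:
  assumes "max_modulus_escaping g R" and d: "d \<ge> 1" and "stretches g d d"
  shows "spiders_web (A_set R g)"
proof -
  interpret max_modulus_escaping g R by fact
  obtain T where "\<forall>\<rho>\<ge>T. \<forall>C. connected C \<longrightarrow> C \<inter> ball 0 \<rho> \<noteq> {} \<longrightarrow>
      \<not> C \<subseteq> ball 0 (\<rho> powr d) \<longrightarrow> \<not> g ` C \<subseteq> ball 0 (max_modulus \<rho> g powr d)"
    using assms(3) unfolding stretches_def eventually_at_top_linorder by (elim exE)
  note T = this[rule_format]
  \<comment> \<open>The bound by \<open>R\<close> serves antimonotonicity, \<open>T\<close>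
    stretching, \<open>1\<close> comparison of powers, and \<open>N\<close> the exhaustion of the
    plane.\<close>
  define r where "r = (\<lambda>N::nat. max (max R T) 1 + N)"
  have r: "r N \<ge> R" "r N \<ge> T" "r N \<ge> 1" "r N \<ge> N" for N
    unfolding r_def by (auto simp: max_def)
  define G where "G = (\<lambda>N. max_modulus_escaping.hole g (r N))"
  have esc: "max_modulus_escaping g (r N)" for N
    using ent nc max_modulus_gt r[of N] by unfold_locales (auto intro: order_trans)
  have bdd: "bounded (G N)" for N
  proof -
    interpret N: max_modulus_escaping g "r N" by (rule esc)
    have "w \<in> ball 0 (r N powr d)" if w: "w \<in> G N" for w
    proof -
      obtain C n where C: "connected C" "0 \<in> C" "w \<in> C" "C \<subseteq> N.below n"
        using N.hole_path w unfolding G_def by blast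
      have "C \<subseteq> ball 0 (r N powr d)"
      proof (rule N.connected_below_subset_ball[OF r(3) d _ C(1,2,4)])
        fix \<rho> and C :: "complex set" assume "\<rho> \<ge> r N"
        then have "\<rho> \<ge> T" using r(2)[of N] by simp
        then show "connected C \<Longrightarrow> C \<inter> ball 0 \<rho> \<noteq> {} \<Longrightarrow> \<not> C \<subseteq> ball 0 (\<rho> powr d) \<Longrightarrow>
          \<not> g ` C \<subseteq> ball 0 (max_modulus \<rho> g powr d)" by (rule T)
      qed
      then show ?thesis using C(3) by blast
    qed
    then show ?thesis using bounded_subset[OF bounded_ball] by blast
  qed
  have ball: "ball 0 (r N) \<subseteq> G N" for N
    unfolding G_def by (rule max_modulus_escaping.ball_subset_hole[OF esc])
  have dom: "simply_connected_domain (G N)" for N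
    using ball[of N] r(3)[of N] max_modulus_escaping.open_hole[OF esc, of N]
      max_modulus_escaping.connected_hole[OF esc, of N] max_modulus_escaping.simply_connected_hole[OF esc, of N]
    unfolding simply_connected_domain_def G_def by force
  have frontier: "frontier (G N) \<subseteq> A_set R g" for N
    using max_modulus_escaping.frontier_hole_subset[OF esc, of N] A_set_antimono[OF r(1)]
    unfolding G_def by blast
  have mono: "G N \<subseteq> G (Suc N)" for N
    unfolding G_def max_modulus_escaping.hole_def[OF esc]
    by (intro connected_component_mono Compl_anti_mono max_modulus_escaping.A_set_antimono[OF esc])
      (simp add: r_def)
  have UN: "(\<Union>N. G N) = UNIV"
  proof -
    have "z \<in> (\<Union>N. G N)" for z
    proof -
      obtain N :: nat where "cmod z < N" using reals_Archimedean2 by blast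
      then have "z \<in> ball 0 (r N)" using r(4)[of N] by simp
      then show ?thesis using ball by blast
    qed
    then show ?thesis by blast
  qed
  have "connected (A_set R g)"
  proof (rule connected_A_set[of G])
    show "open (G N)" for N using dom unfolding simply_connected_domain_def by blast
    show "connected (frontier (G N))" for N
      using max_modulus_escaping.connected_frontier_hole[OF esc] bdd unfolding G_def by blast
  qed (fact bdd frontier mono UN)+
  then show ?thesis
    unfolding spiders_web_def using bdd dom mono frontier UN by blast
qed

theorem theorem3p2:
  fixes k :: nat
    and f :: "nat \<Rightarrow> complex \<Rightarrow> complex"
    and g :: "complex \<Rightarrow> complex"
    and R :: real
  assumes "k \<ge> 1"
    and "\<forall>j\<in>{1..k}. entire (f j)"
    and "\<forall>j\<in>{1..k}. \<exists>m>1. annular_domain_property m (f j)"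
    and "\<exists>j\<in>{1..k}. log_regular (f j)"
    and "g = foldr (\<circ>) (map f [1..<Suc k]) id"
    and "R > 0"
    and "\<forall>r\<ge>R. max_modulus r g > r"
  shows "spiders_web (A_set R g)"
proof -
  have set: "set [1..<Suc k] = {1..k}" by auto
  have ent: "entire g"
    unfolding assms(5) using assms(2) set by (intro entire_foldr_compose) blast
  have nc: "\<not> g constant_on UNIV"
  proof
    assume "g constant_on UNIV"
    then obtain c where c: "\<And>z. g z = c" by (auto simp: constant_on_def)
    \<comment> \<open>At this radius the constant value is too small for
      \<open>max_modulus r g > r\<close>.\<close>
    define r where "r = max R (cmod c)"
    have "max_modulus r g = cmod c"
      using max_modulus_attained[OF ent, of r] assms(6) c by (auto simp: r_def)
    moreover have "max_modulus r g > r" using assms(7) unfolding r_def by (metis max.cobounded1)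
    ultimately show False by (auto simp: r_def)
  qed
  have ncj: "\<not> f j constant_on UNIV" if "j \<in> {1..k}" for j
    using foldr_compose_nonconstant nc that set unfolding assms(5) by metis
  have "mildly_contracting (f j)" if j: "j \<in> {1..k}" for j
    using mildly_contracting_if_adp ncj[OF j] assms(2,3) j by blast
  moreover have "\<exists>j\<in>{1..k}. strongly_stretching (f j)"
    using strongly_stretching_if_log_regular ncj assms(3,4) by blast
  ultimately have "strongly_stretching g"
    using foldr_compose_growth[of "[1..<Suc k]" f] assms(2) nc set unfolding assms(5) by blast
  \<comment> \<open>The choice \<open>B = 1\<close> suffices: an exponent that is merely reproduced
    can be iterated.\<close>
  then obtain d where "d \<ge> 1" "stretches g d (1 * d)"
    unfolding strongly_stretching_def by blast
  moreover have "max_modulus_escaping g R"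
    using ent nc assms(6,7) by unfold_locales auto
  ultimately show ?thesis using spiders_web_A_set by simp
qed

end
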